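(* Suppose that the crack size measure $\rho$ has the non decreasing stress hazard property, i.e. the function $H(\kappa)=\rho\left(\left]\frac1{\kappa^2},\infty\right[\right)$ is convex in $\kappa\in\mathbb{R}_+$. Then the function $h:\mathbb{R}^{3\times3}\to\mathbb{R}$, $$h(q)=\frac1{4\pi}\int_{S^2}\Phi\left(\frac\pi4\left(\frac{K_{Ic}}{(n\cdot q\,n)^+}\right)^2\right)dn,$$ is convex.
   Context: $\mathbb{R}_+=]0,\infty[$. A crack size measure $\rho$ is a positive Radon measure on $(\mathbb{R}_+,\mathcal{B}(\mathbb{R}_+))$ with $\rho([c,\infty[)<\infty$ for all $c>0$. $\Phi(s)=\rho(]s,\infty[)$ for $s>0$, and $\Phi(\infty)=0$. $K_{Ic}>0$ is a constant, $t^+=\max\{t,0\}$, $dn$ is the surface measure on the unit sphere $S^2\subset\mathbb{R}^3$. If $(n\cdot qn)^+=0$ the argument of $\Phi$ is interpreted as $\infty$, so the integrand is $0$. *)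

theory Defs
  imports "HOL-Analysis.Analysis"
begin

definition radon_measure_on :: "'a::t2_space set \<Rightarrow> 'a measure \<Rightarrow> bool" where
  "radon_measure_on X M \<longleftrightarrow>
     sets M = sets (restrict_space borel X) \<and>
     (\<forall>K. compact K \<and> K \<subseteq> X \<longrightarrow> emeasure M K < \<infinity>) \<and>
     (\<forall>A\<in>sets M. emeasure M A = (SUP K\<in>{K. compact K \<and> K \<subseteq> A}. emeasure M K))"

definition crack_size_measure :: "real measure \<Rightarrow> bool" where
  "crack_size_measure \<rho> \<longleftrightarrow>
     radon_measure_on {0<..} \<rho> \<and> (\<forall>c>0. emeasure \<rho> {c..} < \<infinity>)"

text \<open>The argument of \<open>\<Phi>\<close> ranges over the positive reals together with \<open>\<infinity>\<close>.  On a crack size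
  measure the real-valued \<^const>\<open>measure\<close> loses nothing, as \<open>{s<..}\<close> has finite mass for \<open>s > 0\<close>.\<close>

definition Phi :: "real measure \<Rightarrow> ereal \<Rightarrow> real" where
  "Phi \<rho> s = (if s = \<infinity> then 0 else measure \<rho> {real_of_ereal s<..})"

definition stress_hazard :: "real measure \<Rightarrow> real \<Rightarrow> real" where
  "stress_hazard \<rho> \<kappa> = measure \<rho> {1 / \<kappa>\<^sup>2<..}"

definition nondecreasing_stress_hazard :: "real measure \<Rightarrow> bool" where
  "nondecreasing_stress_hazard \<rho> \<longleftrightarrow> convex_on {0<..} (stress_hazard \<rho>)"

definition spherical :: "real \<times> real \<Rightarrow> real^3" where
  "spherical = (\<lambda>(\<theta>, \<phi>). vector [sin \<theta> * cos \<phi>, sin \<theta> * sin \<phi>, cos \<theta>])"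

text \<open>Surface measure on the unit sphere as the push-forward of the area element
  \<open>sin \<theta> d\<theta> d\<phi>\<close>, where \<open>sin \<theta>\<close> is the norm of the cross product of the two partial derivatives
  of \<^const>\<open>spherical\<close> (see \<open>spherical_area_element\<close> below).  Poles and the seam
  \<open>\<phi> = 0, 2\<pi>\<close> are covered more than once, but these are null sets.\<close>

definition sphere_measure :: "(real^3) measure" where
  "sphere_measure =
     distr (density lborel (\<lambda>(\<theta>, \<phi>). ennreal (sin \<theta>) * indicator ({0..pi} \<times> {0..2*pi}) (\<theta>, \<phi>)))
           (restrict_space borel (sphere 0 1)) spherical"

text \<open>In \<^typ>\<open>ereal\<close>, dividing a positive number by \<open>0\<close> gives \<open>\<infinity>\<close>, so the argument of
  \<^const>\<open>Phi\<close> is \<open>\<infinity>\<close> where the positive part vanishes (see \<open>stress_argument_infinity\<close> below).\<close>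

definition stress_argument :: "real \<Rightarrow> real^3^3 \<Rightarrow> real^3 \<Rightarrow> ereal" where
  "stress_argument K q n = ereal (pi / 4) * (ereal K / ereal (max (n \<bullet> (q *v n)) 0))\<^sup>2"

definition crack_intensity :: "real measure \<Rightarrow> real \<Rightarrow> real^3^3 \<Rightarrow> real" where
  "crack_intensity \<rho> K q =
     1 / (4 * pi) * (\<integral>n. Phi \<rho> (stress_argument K q n) \<partial>sphere_measure)"


lemma stress_argument_infinity:
  assumes "K > 0" "max (n \<bullet> (q *v n)) 0 = 0"
  shows "stress_argument K q n = \<infinity>"
  using assms by (simp add: stress_argument_def divide_ereal_def power2_eq_square)

lemma stress_argument_finite:
  assumes "n \<bullet> (q *v n) > 0"
  shows "stress_argument K q n = ereal (pi / 4 * (K / (n \<bullet> (q *v n)))\<^sup>2)"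
  using assms by (simp add: stress_argument_def max_def power2_eq_square)

lemma spherical_in_sphere: "spherical p \<in> sphere 0 1"
proof -
  obtain \<theta> \<phi> where p: "p = (\<theta>, \<phi>)" by (cases p)
  have "(sin \<theta> * cos \<phi>)\<^sup>2 + (sin \<theta> * sin \<phi>)\<^sup>2 + (cos \<theta>)\<^sup>2
      = (sin \<theta>)\<^sup>2 * ((sin \<phi>)\<^sup>2 + (cos \<phi>)\<^sup>2) + (cos \<theta>)\<^sup>2"
    by (simp only: power_mult_distrib distrib_left)
  then have "(sin \<theta> * cos \<phi>)\<^sup>2 + (sin \<theta> * sin \<phi>)\<^sup>2 + (cos \<theta>)\<^sup>2 = 1"
    by simp
  then show ?thesis
    unfolding p spherical_def
    by (simp add: norm_eq_sqrt_inner inner_vec_def sum_3 del: power_mult_distrib flip: power2_eq_square)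
qed

lemma continuous_spherical: "continuous_on UNIV spherical"
proof -
  have "continuous_on UNIV (\<lambda>p. spherical p $ i)" for i
  proof -
    have "continuous_on UNIV (\<lambda>p::real \<times> real. sin (fst p) * cos (snd p))"
      and "continuous_on UNIV (\<lambda>p::real \<times> real. sin (fst p) * sin (snd p))"
      and "continuous_on UNIV (\<lambda>p::real \<times> real. cos (fst p))"
      by (intro continuous_intros)+
    then show ?thesis
      using exhaust_3[of i] by (auto simp: spherical_def case_prod_unfold)
  qed
  then have "continuous_on UNIV (\<lambda>p. \<chi> i. spherical p $ i)"
    by (intro continuous_on_vec_lambda)
  then show ?thesis by simp
qed

lemma spherical_area_element:
  fixes \<theta> \<phi> :: real
  assumes "\<theta> \<in> {0..pi}"
  defines "u \<equiv> vector [cos \<theta> * cos \<phi>, cos \<theta> * sin \<phi>, - sin \<theta>] :: real^3"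
    and "v \<equiv> vector [- sin \<theta> * sin \<phi>, sin \<theta> * cos \<phi>, 0] :: real^3"
  shows "((\<lambda>t. spherical (t, \<phi>)) has_vector_derivative u) (at \<theta>)"
    and "((\<lambda>t. spherical (\<theta>, t)) has_vector_derivative v) (at \<phi>)"
    and "norm (cross3 u v) = sin \<theta>"
proof -
  have *: "(f has_vector_derivative f') (at x)"
    if "\<And>i. ((\<lambda>t. f t $ i) has_real_derivative f' $ i) (at x)"
    for f :: "real \<Rightarrow> real^3" and f' x
    unfolding has_vector_derivative_def has_derivative_componentwise_within[of f]
    using that
    by (auto simp: has_field_derivative_def Basis_vec_def inner_axis mult_commute_abs)
  show "((\<lambda>t. spherical (t, \<phi>)) has_vector_derivative u) (at \<theta>)"
  proof (rule *)
    fix i :: 3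
    show "((\<lambda>t. spherical (t, \<phi>) $ i) has_real_derivative u $ i) (at \<theta>)"
      using exhaust_3[of i] by (auto simp: spherical_def u_def intro!: derivative_eq_intros)
  qed
  show "((\<lambda>t. spherical (\<theta>, t)) has_vector_derivative v) (at \<phi>)"
  proof (rule *)
    fix i :: 3
    show "((\<lambda>t. spherical (\<theta>, t) $ i) has_real_derivative v $ i) (at \<phi>)"
      using exhaust_3[of i] by (auto simp: spherical_def v_def intro!: derivative_eq_intros)
  qed
  have "cross3 u v = sin \<theta> *\<^sub>R spherical (\<theta>, \<phi>)"
  proof -
    have "cos \<phi> * (cos \<phi> * (cos \<theta> * sin \<theta>)) + cos \<theta> * (sin \<phi> * (sin \<phi> * sin \<theta>))
        = cos \<theta> * sin \<theta> * ((sin \<phi>)\<^sup>2 + (cos \<phi>)\<^sup>2)"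
      unfolding power2_eq_square by (simp only: algebra_simps)
    then have "cos \<phi> * (cos \<phi> * (cos \<theta> * sin \<theta>)) + cos \<theta> * (sin \<phi> * (sin \<phi> * sin \<theta>))
        = cos \<theta> * sin \<theta>"
      by (simp only: sin_cos_squared_add mult_1_right)
    then show ?thesis
      by (simp add: cross3_def vec_eq_iff forall_3 u_def v_def spherical_def algebra_simps)
  qed
  then show "norm (cross3 u v) = sin \<theta>"
    using spherical_in_sphere[of "(\<theta>, \<phi>)"] assms(1) by (simp add: sin_ge_zero)
qed

lemma space_sphere_measure: "space sphere_measure = sphere 0 1"
  by (simp add: sphere_measure_def space_restrict_space)

lemma emeasure_sphere_measure: "emeasure sphere_measure (sphere 0 1) = ennreal (4 * pi)"
proof -
  let ?g = "\<lambda>(\<theta>, \<phi>). ennreal (sin \<theta>) * indicator ({0..pi} \<times> {0..2*pi}) (\<theta>, \<phi>)"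
  have g: "?g \<in> borel_measurable (lborel \<Otimes>\<^sub>M lborel)"
    by (auto simp: indicator_times case_prod_unfold)
  have sph: "spherical \<in> borel \<rightarrow>\<^sub>M restrict_space borel (sphere 0 1)"
    using spherical_in_sphere continuous_spherical
    by (intro measurable_restrict_space2) (auto intro: borel_measurable_continuous_onI)
  have "emeasure sphere_measure (sphere 0 1) = emeasure (density lborel ?g) UNIV"
    unfolding sphere_measure_def
    using sph spherical_in_sphere
    by (subst emeasure_distr) (auto simp: sets_restrict_space_iff intro!: arg_cong2[where f=emeasure])
  also have "\<dots> = (\<integral>\<^sup>+p. ?g p \<partial>(lborel \<Otimes>\<^sub>M lborel))"
    using g by (subst emeasure_density) (auto simp: lborel_prod)
  also have "\<dots> = (\<integral>\<^sup>+\<theta>. \<integral>\<^sup>+\<phi>. ?g (\<theta>, \<phi>) \<partial>lborel \<partial>lborel)"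
    using g by (rule lborel.nn_integral_fst[symmetric])
  also have "\<dots> = (\<integral>\<^sup>+\<theta>. ennreal (2 * pi) * (ennreal (sin \<theta>) * indicator {0..pi} \<theta>) \<partial>lborel)"
  proof (intro nn_integral_cong)
    fix \<theta> :: real
    have "(\<integral>\<^sup>+\<phi>. ?g (\<theta>, \<phi>) \<partial>lborel)
        = (\<integral>\<^sup>+\<phi>. (ennreal (sin \<theta>) * indicator {0..pi} \<theta>) * indicator {0..2*pi} \<phi> \<partial>lborel)"
      by (simp add: indicator_times mult.assoc)
    then show "(\<integral>\<^sup>+\<phi>. ?g (\<theta>, \<phi>) \<partial>lborel)
        = ennreal (2 * pi) * (ennreal (sin \<theta>) * indicator {0..pi} \<theta>)"
      by (simp add: nn_integral_cmult mult.commute)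
  qed
  also have "\<dots> = ennreal (2 * pi) * (\<integral>\<^sup>+\<theta>. ennreal (sin \<theta>) * indicator {0..pi} \<theta> \<partial>lborel)"
    by (rule nn_integral_cmult) measurable
  also have "(\<integral>\<^sup>+\<theta>. ennreal (sin \<theta>) * indicator {0..pi} \<theta> \<partial>lborel) = ennreal (- cos pi - - cos 0)"
    by (rule nn_integral_FTC_Icc)
       (auto intro!: derivative_eq_intros sin_ge_zero)
  finally show ?thesis
    by (simp flip: ennreal_mult ennreal_numeral)
qed

end

theory Submission
  imports Defs
begin

text \<open>At a direction \<open>n\<close> the integrand is the stress hazard \<open>H\<close> evaluated at a positive multiple of
  the normal stress \<open>n \<bullet> (q *v n)\<close>, a linear functional of \<open>q\<close>, and it is \<open>0\<close> where this
  functional is not positive (\<open>Phi_stress_argument\<close>).  The point is that extending \<open>H\<close> by \<open>0\<close> to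
  the nonpositive half-line preserves convexity (\<open>convex_on_extend_by_zero\<close>): \<open>H\<close> is nondecreasing
  and tends to \<open>0\<close> at \<open>0\<close>, because the tails of \<open>\<rho>\<close> have finite mass and shrink to the empty set.
  So the integrand is convex in \<open>q\<close> for each \<open>n\<close>, and integrating over \<open>n\<close> preserves the
  convexity inequality.  The integrals exist since a convex function on the whole line is
  continuous, which makes the integrand continuous in \<open>n\<close> on a compact set of finite measure.\<close>

text \<open>Only a chord from \<open>x \<le> 0\<close> to \<open>y > 0\<close> needs an argument, at its points \<open>z > 0\<close>.  Such a
  point \<open>z = (1 - t) x + t y\<close> is at most \<open>t y\<close>, hence less than \<open>t y + (1 - t) \<epsilon>\<close> for every
  \<open>\<epsilon> > 0\<close>; monotonicity and convexity bound \<open>f z\<close> by \<open>t f y + (1 - t) f \<epsilon>\<close>, and \<open>f \<epsilon>\<close> vanishes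
  in the limit.\<close>
lemma convex_on_extend_by_zero:
  fixes f :: "real \<Rightarrow> real"
  assumes conv: "convex_on {0<..} f"
    and mono: "mono_on {0<..} f"
    and nonneg: "\<And>x. x > 0 \<Longrightarrow> f x \<ge> 0"
    and lim: "(f \<longlongrightarrow> 0) (at_right 0)"
  shows "convex_on UNIV (\<lambda>x. if x > 0 then f x else 0)"
proof (rule convex_on_linorderI)
  fix t x y :: real
  assume t: "0 < t" "t < 1" and "x < y"
  define z where "z = (1 - t) * x + t * y"
  have "(if z > 0 then f z else 0)
      \<le> (1 - t) * (if x > 0 then f x else 0) + t * (if y > 0 then f y else 0)"
  proof (cases "x > 0")
    case True
    then have "z > 0"
      using t \<open>x < y\<close> by (simp add: z_def add_pos_pos)
    then show ?thesis
      using True t \<open>x < y\<close> convex_onD[OF conv, of t x y] by (simp add: z_def)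
  next
    case x: False
    show ?thesis
    proof (cases "z > 0")
      case False
      then show ?thesis using x t nonneg[of y] by simp
    next
      case True
      have "(1 - t) * x \<le> 0"
        using x t by (simp add: mult_nonneg_nonpos)
      then have z_le: "z \<le> t * y" by (simp add: z_def)
      then have y: "y > 0" using True t by (smt (verit) mult_nonneg_nonpos)
      have "f z \<le> (1 - t) * f e + t * f y" if "e > 0" for e
      proof -
        have "(1 - t) * e > 0" using t that by simp
        then have "f z \<le> f ((1 - t) * e + t * y)"
          using z_le True by (intro mono_onD[OF mono]) auto
        also have "\<dots> \<le> (1 - t) * f e + t * f y"
          using convex_onD[OF conv, of t e y] t y that by simp
        finally show ?thesis .
      qed
      then have "\<forall>\<^sub>F e in at_right 0. f z \<le> (1 - t) * f e + t * f y"
        by (auto simp: eventually_at_filter)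
      moreover have "((\<lambda>e. (1 - t) * f e + t * f y) \<longlongrightarrow> (1 - t) * 0 + t * f y) (at_right 0)"
        by (intro tendsto_intros lim)
      ultimately have "f z \<le> (1 - t) * 0 + t * f y"
        by (intro tendsto_lowerbound[where F = "at_right 0"]) auto
      then show ?thesis using x y True by simp
    qed
  qed
  then show "(if (1 - t) *\<^sub>R x + t *\<^sub>R y > 0 then f ((1 - t) *\<^sub>R x + t *\<^sub>R y) else 0)
      \<le> (1 - t) * (if x > 0 then f x else 0) + t * (if y > 0 then f y else 0)"
    unfolding z_def real_scaleR_def .
qed simp

lemma crack_size_measure_tail_fmeasurable:
  assumes \<rho>: "crack_size_measure \<rho>" and s: "s > 0"
  shows "{s<..} \<in> fmeasurable \<rho>"
proof (rule fmeasurableI2)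
  have sets: "sets \<rho> = sets (restrict_space borel {0<..})"
    using \<rho> by (simp add: crack_size_measure_def radon_measure_on_def)
  show "{s<..} \<in> sets \<rho>"
    using s unfolding sets by (subst sets_restrict_space_iff) auto
  have "{s..} \<in> sets \<rho>"
    using s unfolding sets by (subst sets_restrict_space_iff) auto
  then show "{s..} \<in> fmeasurable \<rho>"
    using \<rho> s by (auto intro: fmeasurableI simp: crack_size_measure_def)
qed auto

lemma crack_size_measure_tail_antimono:
  assumes "crack_size_measure \<rho>" "0 < s" "s \<le> t"
  shows "measure \<rho> {t<..} \<le> measure \<rho> {s<..}"
  using assms crack_size_measure_tail_fmeasurable[of \<rho> s] crack_size_measure_tail_fmeasurable[of \<rho> t]
  by (intro measure_mono_fmeasurable) (auto dest: fmeasurableD)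

lemma crack_size_measure_tail_tendsto_0:
  assumes \<rho>: "crack_size_measure \<rho>"
  shows "((\<lambda>s. measure \<rho> {s<..}) \<longlongrightarrow> 0) at_top"
proof -
  \<comment> \<open>The index is shifted because the tails are controlled only at positive thresholds.\<close>
  let ?A = "\<lambda>n. {real (Suc n)<..}"
  have fin: "?A n \<in> fmeasurable \<rho>" for n
    by (rule crack_size_measure_tail_fmeasurable[OF \<rho>]) simp
  have empty: "(\<Inter>n. ?A n) = {}"
  proof -
    have "x \<notin> ?A (nat \<lceil>x\<rceil>)" for x
      unfolding greaterThan_iff by linarith
    then show ?thesis by blast
  qed
  have "(\<lambda>n. measure \<rho> (?A n)) \<longlonglongrightarrow> measure \<rho> (\<Inter>n. ?A n)"
    using fin by (intro Lim_measure_decseq) (auto simp: decseq_def dest: fmeasurableD fmeasurableD2)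
  then have lim: "(\<lambda>n. measure \<rho> (?A n)) \<longlonglongrightarrow> 0"
    unfolding empty by simp
  show ?thesis
  proof (rule decreasing_tendsto)
    fix e :: real
    assume "0 < e"
    then obtain n where n: "measure \<rho> (?A n) < e"
      using order_tendstoD(2)[OF lim] by (auto simp: eventually_sequentially)
    have "measure \<rho> {s<..} < e" if "s \<ge> real (Suc n)" for s
      using crack_size_measure_tail_antimono[OF \<rho>, of "real (Suc n)" s] n that by simp
    then show "\<forall>\<^sub>F s in at_top. measure \<rho> {s<..} < e"
      unfolding eventually_at_top_linorder by blast
  qed simp
qed

definition extended_hazard :: "real measure \<Rightarrow> real \<Rightarrow> real" where
  "extended_hazard \<rho> \<kappa> = (if \<kappa> > 0 then stress_hazard \<rho> \<kappa> else 0)"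

lemma stress_hazard_mono:
  assumes "crack_size_measure \<rho>"
  shows "mono_on {0<..} (stress_hazard \<rho>)"
  unfolding stress_hazard_def
  by (intro mono_onI crack_size_measure_tail_antimono[OF assms])
     (auto intro!: divide_left_mono power_mono)

lemma stress_hazard_tendsto_0:
  assumes "crack_size_measure \<rho>"
  shows "(stress_hazard \<rho> \<longlongrightarrow> 0) (at_right 0)"
proof -
  have "filterlim (\<lambda>\<kappa>::real. (inverse \<kappa>)\<^sup>2) at_top (at_right 0)"
    by (intro filterlim_pow_at_top filterlim_inverse_at_top_right) simp
  then have "filterlim (\<lambda>\<kappa>::real. 1 / \<kappa>\<^sup>2) at_top (at_right 0)"
    by (simp add: power_inverse inverse_eq_divide power_divide)
  from filterlim_compose[OF crack_size_measure_tail_tendsto_0[OF assms] this]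
  show ?thesis by (simp add: stress_hazard_def[abs_def])
qed

lemma convex_extended_hazard:
  assumes "crack_size_measure \<rho>" "nondecreasing_stress_hazard \<rho>"
  shows "convex_on UNIV (extended_hazard \<rho>)"
  unfolding extended_hazard_def[abs_def]
proof (rule convex_on_extend_by_zero)
  show "convex_on {0<..} (stress_hazard \<rho>)"
    using assms(2) by (simp add: nondecreasing_stress_hazard_def)
  show "stress_hazard \<rho> \<kappa> \<ge> 0" for \<kappa>
    by (simp add: stress_hazard_def)
qed (simp_all add: assms(1) stress_hazard_mono stress_hazard_tendsto_0)

text \<open>The constant solves \<open>1 / \<kappa>\<^sup>2 = pi / 4 * (K / x)\<^sup>2\<close> for \<open>\<kappa>\<close> in terms of the normal stress \<open>x\<close>.\<close>
lemma Phi_stress_argument: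
  assumes "K > 0"
  shows "Phi \<rho> (stress_argument K q n) = extended_hazard \<rho> (2 / (sqrt pi * K) * (n \<bullet> (q *v n)))"
proof (cases "n \<bullet> (q *v n) > 0")
  case True
  define x where "x = n \<bullet> (q *v n)"
  have "x > 0" using True by (simp add: x_def)
  have eq: "1 / (2 / (sqrt pi * K) * x)\<^sup>2 = pi / 4 * (K / x)\<^sup>2"
    using assms \<open>x > 0\<close> by (simp add: field_simps)
  have "2 / (sqrt pi * K) * x > 0"
    using assms \<open>x > 0\<close> by simp
  then show ?thesis
    unfolding extended_hazard_def stress_hazard_def Phi_def stress_argument_finite[OF True]
      x_def[symmetric] eq
    by (simp only: if_True real_of_ereal.simps PInfty_neq_ereal if_False)
next
  case False
  then have "\<not> 2 / (sqrt pi * K) * (n \<bullet> (q *v n)) > 0"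
    using assms by (simp add: zero_less_mult_iff zero_less_divide_iff not_less)
  moreover have "max (n \<bullet> (q *v n)) 0 = 0" using False by simp
  ultimately show ?thesis
    using stress_argument_infinity[OF assms, of n q]
    by (simp add: Phi_def extended_hazard_def)
qed

lemma integrable_sphere_measure_continuous:
  fixes f :: "real^3 \<Rightarrow> real"
  assumes "continuous_on UNIV f"
  shows "integrable sphere_measure f"
proof -
  interpret finite_measure sphere_measure
    by (rule finite_measureI) (simp add: space_sphere_measure emeasure_sphere_measure)
  have "bounded (f ` sphere 0 1)"
    using assms by (intro compact_imp_bounded compact_continuous_image)
      (auto intro: continuous_on_subset)
  then obtain B where "\<forall>n\<in>sphere 0 1. norm (f n) \<le> B"
    by (auto simp: bounded_iff)
  then have "AE n in sphere_measure. norm (f n) \<le> B"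
    by (intro AE_I2) (simp only: space_sphere_measure)
  moreover have "f \<in> borel_measurable (restrict_space borel (sphere 0 1))"
    using assms by (intro measurable_restrict_space1 borel_measurable_continuous_onI)
  then have "f \<in> borel_measurable sphere_measure"
    by (simp add: sphere_measure_def)
  ultimately show ?thesis by (rule integrable_const_bound)
qed

lemma convex_on_integral:
  fixes f :: "'a::real_vector \<Rightarrow> 'b \<Rightarrow> real"
  assumes S: "convex S"
    and int: "\<And>q. q \<in> S \<Longrightarrow> integrable M (f q)"
    and conv: "\<And>n. n \<in> space M \<Longrightarrow> convex_on S (\<lambda>q. f q n)"
  shows "convex_on S (\<lambda>q. \<integral>n. f q n \<partial>M)"
proof (rule convex_onI)
  fix t :: real and p q
  assume t: "0 < t" "t < 1" and pq: "p \<in> S" "q \<in> S"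
  have "(1 - t) *\<^sub>R p + t *\<^sub>R q \<in> S"
    using t pq by (intro convexD[OF S]) auto
  then have "(\<integral>n. f ((1 - t) *\<^sub>R p + t *\<^sub>R q) n \<partial>M) \<le> (\<integral>n. (1 - t) * f p n + t * f q n \<partial>M)"
    using t pq by (intro integral_mono int Bochner_Integration.integrable_add
        Bochner_Integration.integrable_mult_right)
      (auto intro: convex_onD[OF conv])
  also have "\<dots> = (1 - t) * (\<integral>n. f p n \<partial>M) + t * (\<integral>n. f q n \<partial>M)"
    using int pq by simp
  finally show "(\<integral>n. f ((1 - t) *\<^sub>R p + t *\<^sub>R q) n \<partial>M)
      \<le> (1 - t) * (\<integral>n. f p n \<partial>M) + t * (\<integral>n. f q n \<partial>M)" .
qed (rule S)

theorem proposition4p2: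
  fixes \<rho> :: "real measure" and K :: real
  assumes "crack_size_measure \<rho>"
    and "K > 0"
    and "nondecreasing_stress_hazard \<rho>"
  shows "convex_on UNIV (crack_intensity \<rho> K)"
proof -
  define G where "G x = extended_hazard \<rho> (2 / (sqrt pi * K) * x)" for x
  have convex_G: "convex_on UNIV G"
  proof (rule convex_onI)
    fix t x y :: real
    assume "0 < t" "t < 1"
    then show "G ((1 - t) *\<^sub>R x + t *\<^sub>R y) \<le> (1 - t) * G x + t * G y"
      using convex_onD[OF convex_extended_hazard[OF assms(1,3)], of t
          "2 / (sqrt pi * K) * x" "2 / (sqrt pi * K) * y"]
      by (simp add: G_def distrib_left mult.left_commute del: times_divide_eq_left)
  qed simp
  then have cont_G: "continuous_on UNIV G"
    by (intro convex_on_continuous) auto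
  have "convex_on UNIV (\<lambda>q::real^3^3. \<integral>n. G (n \<bullet> (q *v n)) \<partial>sphere_measure)"
  proof (rule convex_on_integral)
    fix q :: "real^3^3"
    have "continuous_on UNIV (\<lambda>n::real^3. n \<bullet> (q *v n))"
      by (intro continuous_intros linear_continuous_on matrix_vector_mul_bounded_linear)
    then show "integrable sphere_measure (\<lambda>n. G (n \<bullet> (q *v n)))"
      by (intro integrable_sphere_measure_continuous continuous_on_compose2[OF cont_G]) auto
  next
    fix n :: "real^3"
    show "convex_on UNIV (\<lambda>q::real^3^3. G (n \<bullet> (q *v n)))"
    proof (rule convex_onI)
      fix t :: real and p q :: "real^3^3"
      assume "0 < t" "t < 1"
      then show "G (n \<bullet> (((1 - t) *\<^sub>R p + t *\<^sub>R q) *v n))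
          \<le> (1 - t) * G (n \<bullet> (p *v n)) + t * G (n \<bullet> (q *v n))"
        using convex_onD[OF convex_G, of t "n \<bullet> (p *v n)" "n \<bullet> (q *v n)"]
        by (simp add: matrix_vector_mult_add_rdistrib inner_right_distrib
            flip: scaleR_matrix_vector_assoc)
    qed simp
  qed simp
  then have "convex_on UNIV (\<lambda>q::real^3^3. 1 / (4 * pi) * (\<integral>n. G (n \<bullet> (q *v n)) \<partial>sphere_measure))"
    by (intro convex_on_cmul) auto
  then show ?thesis
    by (simp add: crack_intensity_def[abs_def] Phi_stress_argument[OF assms(2)] G_def)
qed

end
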